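(* Let $\Lambda\ge 0$ and assume that for any $x\in\mathcal{X}$ we have $\{(h(x,1),\ldots,h(x,n))\colon h\in\mathcal{H}\}=[-\Lambda,+\Lambda]^n$. Then, for the comp-sum losses $\ell_\tau^{\rm comp}$, $\tau\in[0,2)$, and any deterministic distribution $\mathcal{D}$, the minimizability gaps satisfy $$\mathcal{M}_{\ell_\tau^{\rm comp}}(\mathcal{H})\ \le\ \widetilde{\mathcal{M}}_{\ell_\tau^{\rm comp}}(\mathcal{H}) := f_\tau\left(\mathcal{E}^*_{\ell_{0}^{\rm comp}}(\mathcal{H})\right)-f_\tau\left(\mathcal{C}^*_{\ell_{0}^{\rm comp}}(\mathcal{H},x)\right),$$ where $\ell_0^{\rm comp}$ is $\ell_\tau^{\rm comp}$ with $\tau=0$, $f_\tau(u)=\log(1+u)$ if $\tau=1$ and $f_\tau(u)=\frac{1}{1-\tau}\left((1+u)^{1-\tau}-1\right)$ if $\tau\neq1$, and $\mathcal{C}^*_{\ell_{0}^{\rm comp}}(\mathcal{H},x)=e^{-2\Lambda}(n-1)$ (independently of $x$). Moreover, $\widetilde{\mathcal{M}}_{\ell_\tau^{\rm comp}}(\mathcal{H})$ is a non-increasing function of $\tau$.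
   Context: Multi-class classification: input space $\mathcal{X}$, label space $\mathcal{Y}=\{1,\ldots,n\}$, $\mathcal{D}$ a distribution over $\mathcal{X}\times\mathcal{Y}$, $\mathcal{H}$ a set of measurable functions $h\colon\mathcal{X}\times\mathcal{Y}\to\mathbb{R}$. $p(x,y)=\mathcal{D}(Y=y\mid X=x)$; $\mathcal{D}$ is deterministic if $p(x,y)\in\{0,1\}$ for all $x,y$. For a loss $\ell(h,x,y)\ge0$: $\mathcal{E}_\ell(h)=\mathbb{E}_{(x,y)\sim\mathcal{D}}[\ell(h,x,y)]$, $\mathcal{E}^*_\ell(\mathcal{H})=\inf_{h\in\mathcal{H}}\mathcal{E}_\ell(h)$, $\mathcal{C}_\ell(h,x)=\sum_{y}p(x,y)\ell(h,x,y)$, $\mathcal{C}^*_\ell(\mathcal{H},x)=\inf_{h\in\mathcal{H}}\mathcal{C}_\ell(h,x)$, and the minimizability gap is $\mathcal{M}_\ell(\mathcal{H})=\mathcal{E}^*_\ell(\mathcal{H})-\mathbb{E}_x[\mathcal{C}^*_\ell(\mathcal{H},x)]$. The comp-sum losses are, for $\tau\in[0,2)$, $$\ell_\tau^{\rm comp}(h,x,y)=\begin{cases}\frac{1}{1-\tau}\left(\left[\sum_{y'\in\mathcal{Y}}e^{h(x,y')-h(x,y)}\right]^{1-\tau}-1\right)&\tau\ne1\\ \log\left(\sum_{y'\in\mathcal{Y}}e^{h(x,y')-h(x,y)}\right)&\tau=1.\end{cases}$$ *)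

theory Defs
  imports "HOL-Probability.Probability"
begin

text \<open>
  The input space is a measurable space \<open>X\<close> and the label space is \<open>{1..n}\<close>. A hypothesis is
  a function on pairs \<open>(x, y)\<close>, and a loss maps a hypothesis, an input and a label to a real.
\<close>

type_synonym 'x hyp = "'x \<times> nat \<Rightarrow> real"
type_synonym 'x loss = "'x hyp \<Rightarrow> 'x \<Rightarrow> nat \<Rightarrow> real"

definition labelled_space :: "'x measure \<Rightarrow> nat \<Rightarrow> ('x \<times> nat) measure" where
  "labelled_space X n = X \<Otimes>\<^sub>M count_space {1..n}"

definition input_marginal :: "'x measure \<Rightarrow> ('x \<times> nat) measure \<Rightarrow> 'x measure" where
  "input_marginal X D = distr D X fst"

text \<open>
  \<open>p x y\<close> is a version of the conditional probability of the label \<open>y\<close> given the input \<open>x\<close>: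
  a probability vector for every \<open>x\<close>, measurable in \<open>x\<close>, that disintegrates \<open>D\<close>.
\<close>

definition label_cond_prob ::
    "'x measure \<Rightarrow> nat \<Rightarrow> ('x \<times> nat) measure \<Rightarrow> ('x \<Rightarrow> nat \<Rightarrow> real) \<Rightarrow> bool" where
  "label_cond_prob X n D p \<longleftrightarrow>
     (\<forall>y\<in>{1..n}. (\<lambda>x. p x y) \<in> borel_measurable X) \<and>
     (\<forall>x\<in>space X. (\<forall>y\<in>{1..n}. 0 \<le> p x y) \<and> (\<Sum>y\<in>{1..n}. p x y) = 1) \<and>
     (\<forall>A\<in>sets X. \<forall>y\<in>{1..n}.
        measure D (A \<times> {y}) = set_lebesgue_integral (input_marginal X D) A (\<lambda>x. p x y))"

definition deterministic :: "'x measure \<Rightarrow> nat \<Rightarrow> ('x \<Rightarrow> nat \<Rightarrow> real) \<Rightarrow> bool" where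
  "deterministic X n p \<longleftrightarrow> (\<forall>x\<in>space X. \<forall>y\<in>{1..n}. p x y \<in> {0, 1})"

text \<open>
  The errors below are real-valued, so they have their intended meaning only for integrable
  losses and nonempty hypothesis sets. Both hold when the hypotheses are measurable and their
  score vectors range over a cube \<open>[-\<Lambda>, \<Lambda>]\<^sup>n\<close>: the comp-sum losses are then bounded.
\<close>

definition gen_error :: "('x \<times> nat) measure \<Rightarrow> 'x loss \<Rightarrow> 'x hyp \<Rightarrow> real" where
  "gen_error D l h = (\<integral>z. l h (fst z) (snd z) \<partial>D)"

definition best_gen_error :: "('x \<times> nat) measure \<Rightarrow> 'x loss \<Rightarrow> 'x hyp set \<Rightarrow> real" where
  "best_gen_error D l H = (INF h\<in>H. gen_error D l h)"

definition cond_error ::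
    "nat \<Rightarrow> ('x \<Rightarrow> nat \<Rightarrow> real) \<Rightarrow> 'x loss \<Rightarrow> 'x hyp \<Rightarrow> 'x \<Rightarrow> real" where
  "cond_error n p l h x = (\<Sum>y\<in>{1..n}. p x y * l h x y)"

definition best_cond_error ::
    "nat \<Rightarrow> ('x \<Rightarrow> nat \<Rightarrow> real) \<Rightarrow> 'x loss \<Rightarrow> 'x hyp set \<Rightarrow> 'x \<Rightarrow> real" where
  "best_cond_error n p l H x = (INF h\<in>H. cond_error n p l h x)"

definition minimizability_gap ::
    "'x measure \<Rightarrow> nat \<Rightarrow> ('x \<times> nat) measure \<Rightarrow> ('x \<Rightarrow> nat \<Rightarrow> real) \<Rightarrow> 'x loss \<Rightarrow>
      'x hyp set \<Rightarrow> real" where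
  "minimizability_gap X n D p l H =
     best_gen_error D l H - (\<integral>x. best_cond_error n p l H x \<partial>input_marginal X D)"

definition comp_sum_loss :: "nat \<Rightarrow> real \<Rightarrow> 'x loss" where
  "comp_sum_loss n \<tau> h x y =
     (let S = (\<Sum>y'\<in>{1..n}. exp (h (x, y') - h (x, y)))
      in if \<tau> = 1 then ln S else 1 / (1 - \<tau>) * (S powr (1 - \<tau>) - 1))"

definition f_comp :: "real \<Rightarrow> real \<Rightarrow> real" where
  "f_comp \<tau> u =
     (if \<tau> = 1 then ln (1 + u) else 1 / (1 - \<tau>) * ((1 + u) powr (1 - \<tau>) - 1))"

definition gap_upper_bound ::
    "nat \<Rightarrow> ('x \<times> nat) measure \<Rightarrow> ('x \<Rightarrow> nat \<Rightarrow> real) \<Rightarrow> 'x hyp set \<Rightarrow> real \<Rightarrow> 'x \<Rightarrow> real" where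
  "gap_upper_bound n D p H \<tau> x =
     f_comp \<tau> (best_gen_error D (comp_sum_loss n 0) H)
     - f_comp \<tau> (best_cond_error n p (comp_sum_loss n 0) H x)"

end

theory Submission
  imports Defs
begin

text \<open>
  Pointwise, \<open>\<ell>\<^sub>\<tau> = f\<^sub>\<tau> \<circ> \<ell>\<^sub>0\<close>, where \<open>f\<^sub>\<tau>\<close> is increasing and concave with
  \<open>f\<^sub>\<tau>' u = (1 + u)\<^sup>-\<^sup>\<tau>\<close>. Jensen's inequality bounds the best generalization error of
  \<open>\<ell>\<^sub>\<tau>\<close> by \<open>f\<^sub>\<tau>\<close> of that of \<open>\<ell>\<^sub>0\<close>. In the deterministic case the conditional error is the
  loss at the one certain label, and it is least when that label scores \<open>\<Lambda>\<close> and all others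
  \<open>-\<Lambda>\<close>. The bound is the integral of \<open>(1 + u)\<^sup>-\<^sup>\<tau>\<close> over an interval of nonnegative \<open>u\<close>, hence
  decreasing in \<open>\<tau>\<close>.
\<close>

section \<open>Calculus of the transformation \<open>f_comp\<close>\<close>

lemma f_comp_has_derivative:
  assumes "u > -1"
  shows "(f_comp \<tau> has_real_derivative (1 + u) powr (-\<tau>)) (at u)"
proof (cases "\<tau> = 1")
  case True
  have "((\<lambda>u. ln (1 + u)) has_real_derivative (1 + u) powr (-\<tau>)) (at u)"
    using assms True by (auto intro!: derivative_eq_intros simp: powr_minus divide_simps)
  then show ?thesis
    using True by (simp add: f_comp_def [abs_def])
next
  case False
  have "((\<lambda>u. 1 / (1 - \<tau>) * ((1 + u) powr (1 - \<tau>) - 1))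
      has_real_derivative (1 / (1 - \<tau>)) * ((1 - \<tau>) * (1 + u) powr (1 - \<tau> - 1))) (at u)"
    using assms by (auto intro!: derivative_eq_intros)
  then show ?thesis
    using False by (simp add: f_comp_def [abs_def])
qed

lemma f_comp_mono:
  assumes "-1 < a" "a \<le> b"
  shows "f_comp \<tau> a \<le> f_comp \<tau> b"
proof (rule DERIV_nonneg_imp_nondecreasing [OF assms(2)])
  fix u assume "a \<le> u" "u \<le> b"
  then show "\<exists>d. (f_comp \<tau> has_real_derivative d) (at u) \<and> 0 \<le> d"
    using assms f_comp_has_derivative [of u \<tau>] by (intro exI [of _ "(1 + u) powr (-\<tau>)"]) auto
qed

text \<open>For \<open>u \<ge> 0\<close> the base \<open>1 + u\<close> is at least 1, so the
  derivative shrinks as the parameter grows; hence \<open>f_comp \<sigma> - f_comp \<tau>\<close> is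
  nondecreasing.\<close>

lemma f_comp_increment_antimono:
  assumes "0 \<le> a" "a \<le> b" "\<sigma> \<le> \<tau>"
  shows "f_comp \<tau> b - f_comp \<tau> a \<le> f_comp \<sigma> b - f_comp \<sigma> a"
proof -
  have "f_comp \<sigma> a - f_comp \<tau> a \<le> f_comp \<sigma> b - f_comp \<tau> b"
  proof (rule DERIV_nonneg_imp_nondecreasing [OF assms(2)])
    fix u assume u: "a \<le> u" "u \<le> b"
    have "((\<lambda>u. f_comp \<sigma> u - f_comp \<tau> u) has_real_derivative
        (1 + u) powr (-\<sigma>) - (1 + u) powr (-\<tau>)) (at u)"
      using u assms by (intro DERIV_diff f_comp_has_derivative) auto
    moreover have "(1 + u) powr (-\<tau>) \<le> (1 + u) powr (-\<sigma>)"
      using u assms by (intro powr_mono) auto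
    ultimately show "\<exists>d. ((\<lambda>u. f_comp \<sigma> u - f_comp \<tau> u) has_real_derivative d) (at u) \<and> 0 \<le> d"
      by (metis diff_ge_0_iff_ge)
  qed
  then show ?thesis by simp
qed

text \<open>For \<open>\<tau> \<ge> 0\<close> the derivative of \<open>f_comp \<tau>\<close> is
  nonincreasing. The sign is flipped to fit the convex form of Jensen's inequality.\<close>

lemma convex_on_minus_f_comp:
  assumes "\<tau> \<ge> 0"
  shows "convex_on {-1<..} (\<lambda>u. - f_comp \<tau> u)"
proof (rule convex_on_realI)
  show "((\<lambda>u. - f_comp \<tau> u) has_real_derivative - ((1 + u) powr (-\<tau>))) (at u)"
    if "u \<in> {-1<..}" for u
    using that by (intro DERIV_minus f_comp_has_derivative) auto
  show "- ((1 + u) powr (-\<tau>)) \<le> - ((1 + v) powr (-\<tau>))"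
    if "u \<in> {-1<..}" "v \<in> {-1<..}" "u \<le> v" for u v
    using that assms by (auto intro!: powr_mono2')
qed auto

lemma f_comp_0 [simp]: "-1 < u \<Longrightarrow> f_comp 0 u = u"
  by (simp add: f_comp_def)

section \<open>Comp-sum losses at a single example\<close>

lemma comp_sum_loss_0:
  assumes "y \<in> {1..n}"
  shows "comp_sum_loss n 0 h x y = (\<Sum>y'\<in>{1..n} - {y}. exp (h (x, y') - h (x, y)))"
proof -
  have "(\<Sum>y'\<in>{1..n}. exp (h (x, y') - h (x, y))) =
      1 + (\<Sum>y'\<in>{1..n} - {y}. exp (h (x, y') - h (x, y)))"
    using assms by (subst sum.remove [of _ y]) auto
  \<comment> \<open>Nonnegativity of the sum gives \<open>S powr 1 = S\<close>; the summand 1 coming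
    from \<open>y' = y\<close> then cancels the \<open>- 1\<close> in the loss.\<close>
  moreover have "0 \<le> (\<Sum>y'\<in>{1..n} - {y}. exp (h (x, y') - h (x, y)))"
    by (intro sum_nonneg) auto
  ultimately show ?thesis
    by (simp add: comp_sum_loss_def)
qed

lemma comp_sum_loss_eq_f_comp:
  assumes "y \<in> {1..n}"
  shows "comp_sum_loss n \<tau> h x y = f_comp \<tau> (comp_sum_loss n 0 h x y)"
proof -
  have "(\<Sum>y'\<in>{1..n}. exp (h (x, y') - h (x, y))) = 1 + comp_sum_loss n 0 h x y"
    using assms by (subst comp_sum_loss_0, simp, subst sum.remove [of _ y]) auto
  then show ?thesis
    by (simp add: comp_sum_loss_def [of n \<tau>] f_comp_def)
qed

text \<open>Each of the \<open>n - 1\<close> score differences lies between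
  \<open>-2 * \<Lambda>\<close> and \<open>2 * \<Lambda>\<close>. The lower bound is the optimal
  value; the upper one serves integrability.\<close>

lemma comp_sum_loss_0_bounds:
  assumes "y \<in> {1..n}" "\<And>y'. y' \<in> {1..n} \<Longrightarrow> h (x, y') \<in> {-\<Lambda>..\<Lambda>}"
  shows "exp (-2 * \<Lambda>) * (real n - 1) \<le> comp_sum_loss n 0 h x y"
    and "comp_sum_loss n 0 h x y \<le> exp (2 * \<Lambda>) * (real n - 1)"
proof -
  have c: "real (card ({1..n} - {y})) = real n - 1"
    using assms(1) by (auto simp: card_Diff_singleton of_nat_diff)
  have d: "- 2 * \<Lambda> \<le> h (x, y') - h (x, y)" "h (x, y') - h (x, y) \<le> 2 * \<Lambda>"
    if "y' \<in> {1..n} - {y}" for y'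
    using assms(2) [of y] assms(2) [of y'] assms(1) that by auto
  have "(\<Sum>y'\<in>{1..n} - {y}. exp (-2 * \<Lambda>)) \<le> comp_sum_loss n 0 h x y"
    using d(1) by (subst comp_sum_loss_0 [OF assms(1)], intro sum_mono) simp
  then show "exp (-2 * \<Lambda>) * (real n - 1) \<le> comp_sum_loss n 0 h x y"
    by (simp only: sum_constant c mult.commute)
  have "comp_sum_loss n 0 h x y \<le> (\<Sum>y'\<in>{1..n} - {y}. exp (2 * \<Lambda>))"
    using d(2) by (subst comp_sum_loss_0 [OF assms(1)], intro sum_mono) simp
  then show "comp_sum_loss n 0 h x y \<le> exp (2 * \<Lambda>) * (real n - 1)"
    by (simp only: sum_constant c mult.commute)
qed

section \<open>Best conditional errors under deterministic labels\<close>

lemma label_prob_degenerate: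
  assumes "label_cond_prob X n D p" "deterministic X n p" "x \<in> space X"
  obtains y where "y \<in> {1..n}" "\<And>y'. y' \<in> {1..n} \<Longrightarrow> p x y' = of_bool (y' = y)"
proof -
  have p01: "p x y \<in> {0, 1}" if "y \<in> {1..n}" for y
    using assms that by (auto simp: deterministic_def)
  have sum1: "(\<Sum>y\<in>{1..n}. p x y) = 1"
    using assms by (auto simp: label_cond_prob_def)
  \<comment> \<open>If no label had probability 1, all would have probability 0 and could not sum to
    1.\<close>
  then obtain y where y: "y \<in> {1..n}" "p x y = 1"
    using p01 by (metis (no_types, lifting) insertE singletonD sum.neutral zero_neq_one)
  have "(\<Sum>y'\<in>{1..n} - {y}. p x y') = 0"
    using sum1 y by (subst (asm) sum.remove [of _ y]) auto
  then have "\<forall>y'\<in>{1..n} - {y}. p x y' = 0"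
    using p01 by (subst (asm) sum_nonneg_eq_0_iff) force+
  then show thesis
    using y by (intro that [of y]) auto
qed

text \<open>Score vectors are restricted to \<open>{1..n}\<close>, so that the cube becomes a set of
  extensional functions.\<close>

locale bounded_scores =
  fixes X :: "'x measure" and n :: nat and H :: "'x hyp set" and \<Lambda> :: real
  assumes scores: "\<And>x. x \<in> space X \<Longrightarrow>
      (\<lambda>h. \<lambda>y\<in>{1..n}. h (x, y)) ` H = {1..n} \<rightarrow>\<^sub>E {-\<Lambda>..\<Lambda>}"
    and Lambda_nonneg: "\<Lambda> \<ge> 0"
begin

lemma score_bound:
  assumes "h \<in> H" "x \<in> space X" "y \<in> {1..n}"
  shows "h (x, y) \<in> {-\<Lambda>..\<Lambda>}"
proof -
  have "(\<lambda>y\<in>{1..n}. h (x, y)) \<in> {1..n} \<rightarrow>\<^sub>E {-\<Lambda>..\<Lambda>}"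
    using scores [OF assms(2)] assms(1) by blast
  then have "(\<lambda>y\<in>{1..n}. h (x, y)) y \<in> {-\<Lambda>..\<Lambda>}"
    using assms(3) by (rule PiE_mem)
  then show ?thesis
    using assms(3) by simp
qed

lemma obtain_optimal_hypothesis:
  assumes "x \<in> space X" "y \<in> {1..n}"
  obtains h where "h \<in> H" "comp_sum_loss n 0 h x y = exp (-2 * \<Lambda>) * (real n - 1)"
proof -
  \<comment> \<open>This vertex of the cube makes every difference to the score of \<open>y\<close>
    equal to \<open>-2 * \<Lambda>\<close>, which attains the lower bound.\<close>
  define g where "g = (\<lambda>y'\<in>{1..n}. if y' = y then \<Lambda> else -\<Lambda>)"
  have "g \<in> {1..n} \<rightarrow>\<^sub>E {-\<Lambda>..\<Lambda>}"
    using Lambda_nonneg by (auto simp: g_def)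
  then obtain h where h: "h \<in> H" and gh: "g = (\<lambda>y\<in>{1..n}. h (x, y))"
    using scores [OF assms(1)] by (metis (no_types, lifting) imageE)
  have hy: "h (x, y') = (if y' = y then \<Lambda> else -\<Lambda>)" if "y' \<in> {1..n}" for y'
    using fun_cong [OF gh, of y'] that by (simp add: g_def)
  have "comp_sum_loss n 0 h x y = (\<Sum>y'\<in>{1..n} - {y}. exp (-2 * \<Lambda>))"
    unfolding comp_sum_loss_0 [OF assms(2)] by (rule sum.cong) (use hy assms(2) in auto)
  also have "\<dots> = exp (-2 * \<Lambda>) * (real n - 1)"
    using assms(2) by (simp add: card_Diff_singleton of_nat_diff)
  finally show thesis
    using h that by blast
qed

lemma best_cond_error_comp_sum:
  assumes "label_cond_prob X n D p" "deterministic X n p" "x \<in> space X"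
  shows "best_cond_error n p (comp_sum_loss n \<tau>) H x = f_comp \<tau> (exp (-2 * \<Lambda>) * (real n - 1))"
proof -
  obtain y where y: "y \<in> {1..n}" "\<And>y'. y' \<in> {1..n} \<Longrightarrow> p x y' = of_bool (y' = y)"
    using label_prob_degenerate [OF assms] by blast
  have cond: "cond_error n p (comp_sum_loss n \<tau>) h x = f_comp \<tau> (comp_sum_loss n 0 h x y)" for h
  proof -
    have "cond_error n p (comp_sum_loss n \<tau>) h x =
        (\<Sum>y'\<in>{1..n}. if y' = y then comp_sum_loss n \<tau> h x y' else 0)"
      unfolding cond_error_def by (rule sum.cong) (use y in auto)
    then show ?thesis
      using y(1) by (simp add: comp_sum_loss_eq_f_comp [OF y(1), of \<tau>])
  qed
  obtain h0 where h0: "h0 \<in> H" "comp_sum_loss n 0 h0 x y = exp (-2 * \<Lambda>) * (real n - 1)"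
    using obtain_optimal_hypothesis [OF assms(3) y(1)] by blast
  show ?thesis
    unfolding best_cond_error_def cond
  \<comment> \<open>As \<open>f_comp \<tau>\<close> is nondecreasing, the minimizer
    \<open>h0\<close> of \<open>comp_sum_loss n 0\<close> at \<open>x\<close> and \<open>y\<close>
    also minimizes the transformed loss.\<close>
  proof (rule cInf_eq_minimum)
    show "f_comp \<tau> (exp (-2 * \<Lambda>) * (real n - 1)) \<in> (\<lambda>h. f_comp \<tau> (comp_sum_loss n 0 h x y)) ` H"
      using h0 by force
  next
    fix v assume "v \<in> (\<lambda>h. f_comp \<tau> (comp_sum_loss n 0 h x y)) ` H"
    then obtain h where h: "h \<in> H" and v: "v = f_comp \<tau> (comp_sum_loss n 0 h x y)"
      by blast
    have "0 \<le> exp (-2 * \<Lambda>) * (real n - 1)"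
      using y(1) by simp
    moreover have "exp (-2 * \<Lambda>) * (real n - 1) \<le> comp_sum_loss n 0 h x y"
      by (intro comp_sum_loss_0_bounds(1) y(1) score_bound h assms(3))
    ultimately show "f_comp \<tau> (exp (-2 * \<Lambda>) * (real n - 1)) \<le> v"
      unfolding v by (intro f_comp_mono) auto
  qed
qed

end

section \<open>Measurability, integrability and lower bounds of the errors\<close>

lemma measurable_comp_sum_loss:
  assumes h [measurable]: "h \<in> borel_measurable (labelled_space X n)"
  shows "(\<lambda>z. comp_sum_loss n \<tau> h (fst z) (snd z)) \<in> borel_measurable (labelled_space X n)"
proof -
  \<comment> \<open>The loss reads \<open>h\<close> at every label of the same input, hence the
    composition with the map that replaces the label by a fixed \<open>y'\<close>.\<close>
  have [measurable]: "(\<lambda>z. h (fst z, y')) \<in> borel_measurable (labelled_space X n)"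
    if "y' \<in> {1..n}" for y'
  proof (rule measurable_compose [OF _ h])
    show "(\<lambda>z. (fst z, y')) \<in> labelled_space X n \<rightarrow>\<^sub>M labelled_space X n"
      using that unfolding labelled_space_def
      by (intro measurable_Pair measurable_fst measurable_const) simp
  qed
  have [measurable]: "(\<lambda>z. \<Sum>y'\<in>{1..n}. exp (h (fst z, y') - h z))
      \<in> borel_measurable (labelled_space X n)"
    by (intro borel_measurable_sum borel_measurable_exp borel_measurable_diff) measurable
  show ?thesis
    unfolding comp_sum_loss_def Let_def by (cases "\<tau> = 1") simp_all
qed

locale bounded_score_learning = bounded_scores X n H \<Lambda> + prob_space D
  for X :: "'x measure" and n H \<Lambda> and D :: "('x \<times> nat) measure" +
  assumes sets_D: "sets D = sets (labelled_space X n)"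
    and H_measurable: "H \<subseteq> borel_measurable (labelled_space X n)"
begin

lemma space_D: "space D = space X \<times> {1..n}"
  using sets_eq_imp_space_eq [OF sets_D] by (simp add: labelled_space_def space_pair_measure)

text \<open>A probability space is nonempty, so some label exists; this keeps
  \<open>real n - 1\<close> nonnegative.\<close>

lemma one_le_n: "1 \<le> n"
  using not_empty space_D by force

lemma H_nonempty: "H \<noteq> {}"
proof -
  obtain x y where "x \<in> space X" "y \<in> {1..n}"
    using not_empty space_D by auto
  then show ?thesis
    using obtain_optimal_hypothesis by blast
qed

lemma min_loss_nonneg: "0 \<le> exp (-2 * \<Lambda>) * (real n - 1)"
  using one_le_n by simp

lemma loss_0_bounds:
  assumes "h \<in> H" "z \<in> space D"
  shows "exp (-2 * \<Lambda>) * (real n - 1) \<le> comp_sum_loss n 0 h (fst z) (snd z)"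
    and "comp_sum_loss n 0 h (fst z) (snd z) \<le> exp (2 * \<Lambda>) * (real n - 1)"
  using assms comp_sum_loss_0_bounds [of "snd z" n h "fst z" \<Lambda>] score_bound [of h "fst z"]
  by (auto simp: space_D)

lemma loss_eq_f_comp:
  assumes "z \<in> space D"
  shows "comp_sum_loss n \<tau> h (fst z) (snd z) = f_comp \<tau> (comp_sum_loss n 0 h (fst z) (snd z))"
  using assms by (intro comp_sum_loss_eq_f_comp) (auto simp: space_D)

lemma loss_bounds:
  assumes "h \<in> H" "z \<in> space D"
  shows "f_comp \<tau> (exp (-2 * \<Lambda>) * (real n - 1)) \<le> comp_sum_loss n \<tau> h (fst z) (snd z)"
    and "comp_sum_loss n \<tau> h (fst z) (snd z) \<le> f_comp \<tau> (exp (2 * \<Lambda>) * (real n - 1))"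
proof -
  note loss_0_bounds [OF assms]
  then show "f_comp \<tau> (exp (-2 * \<Lambda>) * (real n - 1)) \<le> comp_sum_loss n \<tau> h (fst z) (snd z)"
    and "comp_sum_loss n \<tau> h (fst z) (snd z) \<le> f_comp \<tau> (exp (2 * \<Lambda>) * (real n - 1))"
    unfolding loss_eq_f_comp [OF assms(2), of \<tau>]
    by (intro f_comp_mono; use min_loss_nonneg in linarith)+
qed

lemma integrable_loss:
  assumes "h \<in> H"
  shows "integrable D (\<lambda>z. comp_sum_loss n \<tau> h (fst z) (snd z))"
proof -
  let ?a = "f_comp \<tau> (exp (-2 * \<Lambda>) * (real n - 1))" and ?b = "f_comp \<tau> (exp (2 * \<Lambda>) * (real n - 1))"
  have "norm (comp_sum_loss n \<tau> h (fst z) (snd z)) \<le> max \<bar>?a\<bar> \<bar>?b\<bar>" if "z \<in> space D" for z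
    using loss_bounds [OF assms that, of \<tau>] unfolding real_norm_def by linarith
  then have "AE z in D. norm (comp_sum_loss n \<tau> h (fst z) (snd z)) \<le> max \<bar>?a\<bar> \<bar>?b\<bar>"
    by (rule AE_I2)
  moreover have "(\<lambda>z. comp_sum_loss n \<tau> h (fst z) (snd z)) \<in> borel_measurable D"
    using measurable_comp_sum_loss H_measurable assms
    by (subst measurable_cong_sets [OF sets_D refl]) blast
  ultimately show ?thesis
    by (intro integrable_const_bound)
qed

lemma gen_error_ge:
  assumes "h \<in> H"
  shows "f_comp \<tau> (exp (-2 * \<Lambda>) * (real n - 1)) \<le> gen_error D (comp_sum_loss n \<tau>) h"
  unfolding gen_error_def
  by (intro integral_ge_const integrable_loss assms AE_I2 loss_bounds(1))

lemma gen_error_bdd_below: "bdd_below (gen_error D (comp_sum_loss n \<tau>) ` H)"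
  by (rule bdd_belowI2) (rule gen_error_ge)

text \<open>This orders the endpoints of the interval over which \<open>f_comp \<tau>\<close> is
  incremented in the upper bound.\<close>

lemma best_gen_error_ge:
  "exp (-2 * \<Lambda>) * (real n - 1) \<le> best_gen_error D (comp_sum_loss n 0) H"
  unfolding best_gen_error_def
  using gen_error_ge [of _ 0] min_loss_nonneg by (intro cINF_greatest H_nonempty) simp

section \<open>Jensen's inequality and the passage to the infimum\<close>

lemma gen_error_le_f_comp:
  assumes "h \<in> H" "\<tau> \<ge> 0"
  shows "gen_error D (comp_sum_loss n \<tau>) h \<le> f_comp \<tau> (gen_error D (comp_sum_loss n 0) h)"
proof -
  let ?L = "\<lambda>\<tau> z. comp_sum_loss n \<tau> h (fst z) (snd z)"
  \<comment> \<open>The identity between the losses is available for labels in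
    \<open>{1..n}\<close>, so the integrands are matched on \<open>space D\<close>.\<close>
  have "integrable D (\<lambda>z. - f_comp \<tau> (?L 0 z)) \<longleftrightarrow> integrable D (\<lambda>z. - ?L \<tau> z)"
    by (intro Bochner_Integration.integrable_cong) (simp_all add: loss_eq_f_comp [of _ \<tau>])
  moreover have "integrable D (\<lambda>z. - ?L \<tau> z)"
    by (intro Bochner_Integration.integrable_minus integrable_loss assms)
  moreover have "AE z in D. ?L 0 z \<in> {-1<..}"
  proof (rule AE_I2)
    fix z assume "z \<in> space D"
    then show "?L 0 z \<in> {-1<..}"
      using loss_0_bounds(1) [OF assms(1)] min_loss_nonneg by fastforce
  qed
  ultimately have "- f_comp \<tau> (\<integral>z. ?L 0 z \<partial>D) \<le> (\<integral>z. - f_comp \<tau> (?L 0 z) \<partial>D)"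
    by (intro jensens_inequality [where q = "\<lambda>u. - f_comp \<tau> u" and I = "{-1<..}" and a = "-1"]
        integrable_loss assms convex_on_minus_f_comp) blast+
  also have "\<dots> = (\<integral>z. - ?L \<tau> z \<partial>D)"
    by (intro Bochner_Integration.integral_cong) (simp_all add: loss_eq_f_comp [of _ \<tau>])
  finally show ?thesis
    by (simp add: gen_error_def)
qed

text \<open>
  The infimum passes through \<open>f\<^sub>\<tau>\<close> because \<open>f\<^sub>\<tau>\<close> is 1-Lipschitz on the nonnegative reals, the
  comparison of its increments with those of \<open>f\<^sub>0\<close>.
\<close>

lemma best_gen_error_le_f_comp:
  assumes "\<tau> \<ge> 0"
  shows "best_gen_error D (comp_sum_loss n \<tau>) H
    \<le> f_comp \<tau> (best_gen_error D (comp_sum_loss n 0) H)"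
proof -
  define e where "e = best_gen_error D (comp_sum_loss n 0) H"
  have e: "0 \<le> e"
    unfolding e_def using best_gen_error_ge min_loss_nonneg by linarith
  \<comment> \<open>The claim is \<open>k \<le> e\<close> rearranged, so it suffices that
    \<open>k\<close> is a lower bound for all errors under \<open>comp_sum_loss n 0\<close>.\<close>
  define k where "k = best_gen_error D (comp_sum_loss n \<tau>) H - f_comp \<tau> e + e"
  have "k \<le> gen_error D (comp_sum_loss n 0) h" if h: "h \<in> H" for h
  proof -
    let ?g = "gen_error D (comp_sum_loss n 0) h"
    have eg: "e \<le> ?g"
      unfolding e_def best_gen_error_def by (rule cINF_lower [OF gen_error_bdd_below h])
    have "best_gen_error D (comp_sum_loss n \<tau>) H \<le> gen_error D (comp_sum_loss n \<tau>) h"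
      unfolding best_gen_error_def by (rule cINF_lower [OF gen_error_bdd_below h])
    also have "\<dots> \<le> f_comp \<tau> ?g"
      by (rule gen_error_le_f_comp [OF h assms])
    also have "\<dots> \<le> f_comp \<tau> e + (?g - e)"
      using f_comp_increment_antimono [OF e eg assms] e eg by simp
    finally show "k \<le> ?g"
      by (simp add: k_def)
  qed
  then have "k \<le> e"
    unfolding e_def best_gen_error_def by (intro cINF_greatest H_nonempty)
  then show ?thesis
    by (simp add: k_def e_def)
qed

text \<open>The best conditional error is constant in the input, so integrating it over the marginal
  changes nothing. Both sides then subtract the same term, and only the best generalization errors
  are compared.\<close>

lemma minimizability_gap_le:
  assumes "label_cond_prob X n D p" "deterministic X n p" "x \<in> space X" "\<tau> \<ge> 0"
  shows "minimizability_gap X n D p (comp_sum_loss n \<tau>) H \<le> gap_upper_bound n D p H \<tau> x"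
proof -
  let ?a = "exp (-2 * \<Lambda>) * (real n - 1)"
  have "fst \<in> measurable D X"
    by (subst measurable_cong_sets [OF sets_D refl]) (simp add: labelled_space_def)
  then interpret M: prob_space "input_marginal X D"
    unfolding input_marginal_def by (rule prob_space_distr)
  have "(\<integral>x. best_cond_error n p (comp_sum_loss n \<tau>) H x \<partial>input_marginal X D) =
      (\<integral>x. f_comp \<tau> ?a \<partial>input_marginal X D)"
    by (intro Bochner_Integration.integral_cong best_cond_error_comp_sum [OF assms(1,2)])
      (simp_all add: input_marginal_def)
  then have "(\<integral>x. best_cond_error n p (comp_sum_loss n \<tau>) H x \<partial>input_marginal X D) = f_comp \<tau> ?a"
    by (simp add: M.prob_space)
  moreover have "best_cond_error n p (comp_sum_loss n 0) H x = ?a"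
    using best_cond_error_comp_sum [OF assms(1-3), of 0] min_loss_nonneg by simp
  ultimately show ?thesis
    using best_gen_error_le_f_comp [OF assms(4)]
    by (simp add: minimizability_gap_def gap_upper_bound_def)
qed

end

theorem theorem15:
  fixes X :: "'x measure" and n :: nat and D :: "('x \<times> nat) measure"
    and p :: "'x \<Rightarrow> nat \<Rightarrow> real" and H :: "'x hyp set" and \<Lambda> :: real
  assumes "prob_space D"
    and "sets D = sets (labelled_space X n)"
    and "label_cond_prob X n D p"
    and "deterministic X n p"
    and "H \<subseteq> borel_measurable (labelled_space X n)"
    and "\<Lambda> \<ge> 0"
    and "\<And>x. x \<in> space X \<Longrightarrow>
      (\<lambda>h. \<lambda>y\<in>{1..n}. h (x, y)) ` H = {1..n} \<rightarrow>\<^sub>E {-\<Lambda>..\<Lambda>}"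
  shows "(\<forall>x\<in>space X.
            best_cond_error n p (comp_sum_loss n 0) H x = exp (-2 * \<Lambda>) * (real n - 1)) \<and>
         (\<forall>\<tau>\<in>{0..<2}. \<forall>x\<in>space X.
            minimizability_gap X n D p (comp_sum_loss n \<tau>) H \<le> gap_upper_bound n D p H \<tau> x) \<and>
         (\<forall>x\<in>space X. antimono_on {0..<2} (\<lambda>\<tau>. gap_upper_bound n D p H \<tau> x))"
proof -
  interpret bounded_score_learning X n H \<Lambda> D
    using assms by (intro bounded_score_learning.intro bounded_scores.intro
        bounded_score_learning_axioms.intro) auto
  have best0: "best_cond_error n p (comp_sum_loss n 0) H x = exp (-2 * \<Lambda>) * (real n - 1)"
    if "x \<in> space X" for x
    using best_cond_error_comp_sum [OF assms(3,4) that, of 0] min_loss_nonneg by simp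
  have "antimono_on {0..<2} (\<lambda>\<tau>. gap_upper_bound n D p H \<tau> x)" if "x \<in> space X" for x
    \<comment> \<open>Neither endpoint of the increment of \<open>f_comp \<tau>\<close> depends on
      \<open>\<tau>\<close>, so the comparison of increments applies directly.\<close>
    unfolding gap_upper_bound_def best0 [OF that]
    by (intro monotone_onI f_comp_increment_antimono min_loss_nonneg best_gen_error_ge)
  then show ?thesis
    using best0 minimizability_gap_le [OF assms(3,4)] by auto
qed

end
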